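(* Let $t\ge 2$ and let $i_1,\dots,i_{t-1}\ge 0$ be integers. Let $\rho$ be the multiset consisting of $i_r$ copies of $r$ for each $1\le r\le t-1$. Then the generating function $P_{R,F}^{(t,t;\rho)}(q)=\sum_\lambda q^{|\lambda|}$, summed over all $t$-regular, $t$-flat partitions $\lambda=(\lambda_1\ge\dots\ge\lambda_k)$ whose residue vector $(\lambda_1 \bmod t,\dots,\lambda_k\bmod t)$ is a permutation of $\rho$, equals $$q^{i_1+2i_2+\dots+(t-1)i_{t-1}}\left[ {{i_1 + \dots + i_{t-1}} \atop {i_1, \dots , i_{t-1}}} \right]_{q^t},$$ where $\left[ {{i_1 + \dots + i_{t-1}} \atop {i_1, \dots , i_{t-1}}} \right]_{x}=\dfrac{(x;x)_{i_1+\dots+i_{t-1}}}{(x;x)_{i_1}\cdots(x;x)_{i_{t-1}}}$.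
   Context: A partition $\lambda_1\ge\dots\ge\lambda_k$ is $t$-regular if no part is divisible by $t$, and $t$-flat if $\lambda_i-\lambda_{i+1}<t$ for $1\le i<k$ and $\lambda_k<t$. Residues are taken in $\{0,1,\dots,t-1\}$. $|\lambda|$ is the sum of parts. Notation: $(a;x)_n=\prod_{i=0}^{n-1}(1-ax^i)$, with $(a;x)_0=1$. *)

theory Defs
  imports "HOL-Library.Multiset" "HOL-Computational_Algebra.Formal_Power_Series"
begin

text \<open>Partitions are weakly decreasing lists of positive integers; the empty list is the
  partition of 0, which is vacuously \<open>t\<close>-regular and \<open>t\<close>-flat.\<close>

definition is_partition :: "nat list \<Rightarrow> bool" where
  "is_partition l \<longleftrightarrow> sorted_wrt (\<ge>) l \<and> (\<forall>x\<in>set l. 0 < x)"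

definition regular_partition :: "nat \<Rightarrow> nat list \<Rightarrow> bool" where
  "regular_partition t l \<longleftrightarrow> (\<forall>x\<in>set l. \<not> t dvd x)"

text \<open>The truncated subtraction below is only used on weakly decreasing lists.\<close>

definition flat_partition :: "nat \<Rightarrow> nat list \<Rightarrow> bool" where
  "flat_partition t l \<longleftrightarrow>
     (\<forall>j. Suc j < length l \<longrightarrow> l ! j - l ! Suc j < t) \<and> (l \<noteq> [] \<longrightarrow> last l < t)"

definition residue_vector :: "nat \<Rightarrow> nat list \<Rightarrow> nat list" where
  "residue_vector t l = map (\<lambda>x. x mod t) l"

definition RF_partitions :: "nat \<Rightarrow> nat multiset \<Rightarrow> nat list set" where
  "RF_partitions t \<rho> =
     {l. is_partition l \<and> regular_partition t l \<and> flat_partition t l \<and>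
         mset (residue_vector t l) = \<rho>}"

text \<open>The series \<open>\<Sum>\<lambda>\<in>A. q^|\<lambda>|\<close>, given by its coefficients; for a set \<open>A\<close> of partitions each of
  the sets counted here is finite.\<close>

definition partition_gf :: "nat list set \<Rightarrow> rat fps" where
  "partition_gf A = Abs_fps (\<lambda>n. of_nat (card {l \<in> A. sum_list l = n}))"

definition P_RF :: "nat \<Rightarrow> nat multiset \<Rightarrow> rat fps" where
  "P_RF t \<rho> = partition_gf (RF_partitions t \<rho>)"

definition residue_multiset :: "nat \<Rightarrow> (nat \<Rightarrow> nat) \<Rightarrow> nat multiset" where
  "residue_multiset t i = (\<Sum>r=1..t-1. replicate_mset (i r) r)"

definition qpoch :: "'a::comm_ring_1 \<Rightarrow> 'a \<Rightarrow> nat \<Rightarrow> 'a" where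
  "qpoch a x n = (\<Prod>j<n. 1 - a * x ^ j)"

text \<open>Division is that of formal power series over a field; if \<open>x\<close> has constant coefficient 0,
  the denominator has constant coefficient 1 and hence is invertible.\<close>

definition qmultinomial :: "nat set \<Rightarrow> (nat \<Rightarrow> nat) \<Rightarrow> rat fps \<Rightarrow> rat fps" where
  "qmultinomial R i x = qpoch x x (\<Sum>r\<in>R. i r) / (\<Prod>r\<in>R. qpoch x x (i r))"

end

theory Submission imports Defs "HOL-Combinatorics.Multiset_Permutations" begin

text \<open>Read a flat partition upwards, starting from an additional part 0. Each part is then the
  least number with the prescribed residue that is not below its predecessor, so its quotient by
  \<open>t\<close> increases by 1 at the descents of the residue word and is unchanged elsewhere. Hence the
  residue word determines the partition and is arbitrary, and \<open>|\<lambda>|\<close> is the sum of the residues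
  plus \<open>t\<close> times the comajor index of the word. What remains is MacMahon's theorem on the
  distribution of this index over the permutations of a multiset. It is the case of a least letter
  \<open>b\<close> in the following statement: the words preceded by an additional letter \<open>b\<close> have the
  \<open>q\<close>-multinomial coefficient times \<open>q\<close> to the number of letters below \<open>b\<close> as their
  generating function. This follows by induction, since the sum over the next letter telescopes.\<close>

section \<open>MacMahon's theorem\<close>

fun comaj :: "'a::linorder list \<Rightarrow> nat" where
  "comaj [] = 0"
| "comaj [b] = 0"
| "comaj (b # c # w) = comaj (c # w) + (if c < b then Suc (length w) else 0)"

lemma comaj_Cons_le:
  assumes "\<And>c. c \<in> set w \<Longrightarrow> b \<le> c"
  shows "comaj (b # w) = comaj w"
  using assms by (cases w) (auto simp: not_less[symmetric])

definition comaj_gf_Cons :: "'b::comm_ring_1 \<Rightarrow> 'a::linorder \<Rightarrow> 'a multiset \<Rightarrow> 'b" where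
  "comaj_gf_Cons x b M = (\<Sum>w\<in>permutations_of_multiset M. x ^ comaj (b # w))"

lemma comaj_gf_Cons_empty [simp]: "comaj_gf_Cons x b {#} = 1"
  by (simp add: comaj_gf_Cons_def)

lemma sum_permutations_of_multiset:
  assumes "M \<noteq> {#}"
  shows "(\<Sum>w\<in>permutations_of_multiset M. f w) =
    (\<Sum>c\<in>set_mset M. \<Sum>w\<in>permutations_of_multiset (M - {#c#}). f (c # w))"
  unfolding permutations_of_multiset_nonempty[OF assms]
  by (subst sum.UNION_disjoint) (auto simp: sum.reindex)

lemma comaj_gf_Cons_rec:
  assumes "M \<noteq> {#}"
  shows "comaj_gf_Cons x b M =
    (\<Sum>c\<in>set_mset M. (if c < b then x ^ size M else 1) * comaj_gf_Cons x c (M - {#c#}))"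
proof -
  have "x ^ comaj (b # c # w) = (if c < b then x ^ size M else 1) * x ^ comaj (c # w)"
    if "c \<in># M" "w \<in> permutations_of_multiset (M - {#c#})" for c w
  proof -
    have "size M = Suc (length w)"
      using that by (metis insert_DiffM permutations_of_multisetD size_add_mset size_mset)
    then show ?thesis
      by (simp add: power_add mult_ac)
  qed
  then show ?thesis
    unfolding comaj_gf_Cons_def sum_permutations_of_multiset[OF assms] sum_distrib_left
    by (intro sum.cong refl)
qed

definition qpoch_mset :: "'b::comm_ring_1 \<Rightarrow> 'a multiset \<Rightarrow> 'b" where
  "qpoch_mset x M = (\<Prod>r\<in>set_mset M. qpoch x x (count M r))"

lemma qpoch_0 [simp]: "qpoch a x 0 = 1"
  by (simp add: qpoch_def)

lemma qpoch_Suc: "qpoch a x (Suc n) = qpoch a x n * (1 - a * x ^ n)"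
  by (simp add: qpoch_def)

lemma qpoch_mset_empty [simp]: "qpoch_mset x {#} = 1"
  by (simp add: qpoch_mset_def)

lemma qpoch_mset_superset:
  assumes "finite R" "set_mset M \<subseteq> R"
  shows "qpoch_mset x M = (\<Prod>r\<in>R. qpoch x x (count M r))"
  unfolding qpoch_mset_def using assms
  by (intro prod.mono_neutral_left) (auto simp: not_in_iff)

lemma qpoch_mset_remove:
  assumes "c \<in># M"
  shows "qpoch_mset x M = (1 - x ^ count M c) * qpoch_mset x (M - {#c#})"
proof -
  let ?R = "set_mset M - {c}" and ?N = "M - {#c#}"
  have count_M: "count M c = Suc (count ?N c)"
    using assms by simp
  have "qpoch_mset x M = qpoch x x (count M c) * (\<Prod>r\<in>?R. qpoch x x (count ?N r))"
    unfolding qpoch_mset_def using assms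
    by (subst prod.remove[of _ c]) (auto intro!: arg_cong2[where f = "(*)"] prod.cong split: if_splits)
  also have "qpoch x x (count M c) = (1 - x ^ count M c) * qpoch x x (count ?N c)"
    unfolding count_M by (simp add: qpoch_Suc)
  also have "\<dots> * (\<Prod>r\<in>?R. qpoch x x (count ?N r)) =
      (1 - x ^ count M c) * (\<Prod>r\<in>set_mset M. qpoch x x (count ?N r))"
    using assms by (subst (2) prod.remove[of _ c]) (auto simp: mult_ac)
  also have "(\<Prod>r\<in>set_mset M. qpoch x x (count ?N r)) = qpoch_mset x ?N"
    by (rule qpoch_mset_superset[symmetric]) (auto dest: in_diffD)
  finally show ?thesis .
qed

lemma sum_prod_less_telescope:
  fixes g :: "'a::linorder \<Rightarrow> 'b::comm_ring_1"
  assumes "finite A"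
  shows "(\<Sum>c\<in>A. prod g {d\<in>A. d < c} * (1 - g c)) = 1 - prod g A"
  using assms
proof (induction A rule: finite_linorder_max_induct)
  case empty
  then show ?case by simp
next
  case (insert b A)
  have "{d \<in> insert b A. d < b} = A"
    using insert.hyps by auto
  moreover have "{d \<in> insert b A. d < c} = {d \<in> A. d < c}" if "c \<in> A" for c
    using insert.hyps that by fastforce
  ultimately have "(\<Sum>c\<in>insert b A. prod g {d \<in> insert b A. d < c} * (1 - g c)) =
      prod g A * (1 - g b) + (\<Sum>c\<in>A. prod g {d\<in>A. d < c} * (1 - g c))"
    using insert.hyps by (subst sum.insert) (auto cong: sum.cong)
  also have "\<dots> = 1 - g b * prod g A"
    unfolding insert.IH by (simp add: algebra_simps)
  also have "\<dots> = 1 - prod g (insert b A)"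
    using insert.hyps by (subst prod.insert) auto
  finally show ?case .
qed

lemma sum_mset_less_telescope:
  fixes M :: "'a::linorder multiset" and x :: "'b::comm_ring_1"
  shows "(\<Sum>c\<in>set_mset M. x ^ size {#d \<in># M. d < c#} * (1 - x ^ count M c)) = 1 - x ^ size M"
  using sum_prod_less_telescope[of "set_mset M" "\<lambda>c. x ^ count M c"]
  by (simp add: size_multiset_overloaded_eq power_sum)

lemma sum_mset_less_telescope_weighted:
  fixes M :: "'a::linorder multiset" and x :: "'b::comm_ring_1"
  shows "(\<Sum>c\<in>set_mset M. (if c < b then y else 1) *
      (x ^ size {#d \<in># M. d < c#} * (1 - x ^ count M c))) =
    y * (1 - x ^ size {#d \<in># M. d < b#}) + (x ^ size {#d \<in># M. d < b#} - x ^ size M)"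
proof -
  define h where "h c = x ^ size {#d \<in># M. d < c#} * (1 - x ^ count M c)" for c
  let ?below = "{#d \<in># M. d < b#}"
  have "{#d \<in># ?below. d < c#} = {#d \<in># M. d < c#}" if "c < b" for c
    using that by (auto simp: filter_filter_mset intro: filter_mset_cong)
  then have "sum h {c \<in> set_mset M. c < b} =
      (\<Sum>c\<in>set_mset ?below. x ^ size {#d \<in># ?below. d < c#} * (1 - x ^ count ?below c))"
    by (intro sum.cong) (auto simp: h_def)
  then have sum_below: "sum h {c \<in> set_mset M. c < b} = 1 - x ^ size ?below"
    by (simp only: sum_mset_less_telescope)
  have "(\<Sum>c\<in>set_mset M. (if c < b then y else 1) * h c) =
      (\<Sum>c\<in>set_mset M. h c + (y - 1) * (if c < b then h c else 0))"
    by (intro sum.cong) (auto simp: algebra_simps)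
  also have "\<dots> = sum h (set_mset M) + (y - 1) * sum h {c \<in> set_mset M. c < b}"
    by (simp add: sum.distrib sum_distrib_left sum.inter_filter)
  also have "\<dots> = (1 - x ^ size M) + (y - 1) * (1 - x ^ size ?below)"
    unfolding sum_below by (simp add: h_def sum_mset_less_telescope)
  finally show ?thesis
    by (simp add: h_def algebra_simps)
qed

lemma qpoch_mset_times_comaj_gf_Cons:
  "qpoch_mset x M * comaj_gf_Cons x b M = x ^ size {#d \<in># M. d < b#} * qpoch x x (size M)"
proof (induction "size M" arbitrary: M b)
  case 0
  then show ?case by simp
next
  case (Suc n)
  let ?weight = "\<lambda>c. if c < b then x ^ size M else 1"
  have next_letter: "qpoch_mset x M * comaj_gf_Cons x c (M - {#c#}) =
      qpoch x x n * (x ^ size {#d \<in># M. d < c#} * (1 - x ^ count M c))" if "c \<in># M" for c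
  proof -
    have "size (M - {#c#}) = n"
      using that Suc.hyps(2) by (simp add: size_Diff_singleton)
    then have "qpoch_mset x (M - {#c#}) * comaj_gf_Cons x c (M - {#c#}) =
        x ^ size {#d \<in># M. d < c#} * qpoch x x n"
      using Suc.hyps(1)[of "M - {#c#}" c] by simp
    then show ?thesis
      unfolding qpoch_mset_remove[OF that] by (simp only: mult.assoc) (simp only: mult_ac)
  qed
  have "M \<noteq> {#}" using Suc.hyps(2) by auto
  have "qpoch_mset x M * comaj_gf_Cons x b M =
      (\<Sum>c\<in>set_mset M. ?weight c * (qpoch_mset x M * comaj_gf_Cons x c (M - {#c#})))"
    unfolding comaj_gf_Cons_rec[OF \<open>M \<noteq> {#}\<close>] sum_distrib_left
    by (intro sum.cong refl mult.left_commute)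
  also have "\<dots> = qpoch x x n *
      (\<Sum>c\<in>set_mset M. ?weight c * (x ^ size {#d \<in># M. d < c#} * (1 - x ^ count M c)))"
    by (simp only: next_letter sum_distrib_left mult.left_commute cong: sum.cong)
  also have "\<dots> = x ^ size {#d \<in># M. d < b#} * (qpoch x x n * (1 - x ^ size M))"
    unfolding sum_mset_less_telescope_weighted by (simp add: algebra_simps)
  also have "qpoch x x n * (1 - x ^ size M) = qpoch x x (size M)"
    by (simp add: qpoch_Suc flip: Suc.hyps(2))
  finally show ?case .
qed

theorem MacMahon_comaj:
  fixes M :: "'a::linorder multiset" and x :: "'b::comm_ring_1"
  shows "qpoch_mset x M * (\<Sum>w\<in>permutations_of_multiset M. x ^ comaj w) = qpoch x x (size M)"
proof -
  define b where "b = Min (set_mset M)"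
  have b_le: "b \<le> c" if "c \<in># M" for c
    using that by (simp add: b_def)
  then have "comaj_gf_Cons x b M = (\<Sum>w\<in>permutations_of_multiset M. x ^ comaj w)"
    unfolding comaj_gf_Cons_def
    by (intro sum.cong refl) (metis comaj_Cons_le permutations_of_multisetD set_mset_mset)
  moreover have "{#d \<in># M. d < b#} = {#}"
    using b_le by (auto simp: filter_mset_eq_conv not_less)
  ultimately show ?thesis
    using qpoch_mset_times_comaj_gf_Cons[of x M b] by (simp only: size_empty power_0 mult_1)
qed

lemma qpoch_nth_0:
  assumes "fps_nth a 0 = 0"
  shows "fps_nth (qpoch a x n) 0 = 1"
  using assms by (induction n) (simp_all add: qpoch_Suc)

corollary qmultinomial_eq_sum_comaj:
  fixes R :: "nat set"
  assumes "finite R" "fps_nth x 0 = 0"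
  shows "qmultinomial R i x =
    (\<Sum>w\<in>permutations_of_multiset (\<Sum>r\<in>R. replicate_mset (i r) r). x ^ comaj w)"
proof -
  define M where "M = (\<Sum>r\<in>R. replicate_mset (i r) r)"
  have count_M: "count M r = (if r \<in> R then i r else 0)" for r
    using assms(1) by (simp add: M_def count_sum)
  then have "set_mset M \<subseteq> R"
    by (metis not_in_iff subsetI)
  then have "qpoch_mset x M = (\<Prod>r\<in>R. qpoch x x (i r))"
    using assms(1) by (simp add: qpoch_mset_superset count_M)
  moreover have "size M = (\<Sum>r\<in>R. i r)"
    by (simp add: M_def)
  moreover have "(\<Prod>r\<in>R. qpoch x x (i r)) \<noteq> 0"
    using assms qpoch_nth_0[of x x] by (metis fps_zero_nth prod_zero_iff zero_neq_one)
  ultimately show ?thesis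
    unfolding qmultinomial_def M_def[symmetric]
    by (metis MacMahon_comaj nonzero_mult_div_cancel_left)
qed

section \<open>Flat partitions and residue words\<close>

definition flat_step :: "nat \<Rightarrow> nat \<Rightarrow> nat \<Rightarrow> bool" where
  "flat_step t m n \<longleftrightarrow> m \<le> n \<and> n < m + t"

lemma flat_step_mult_add_iff:
  assumes "r < t" "s < t"
  shows "flat_step t (q * t + r) (p * t + s) \<longleftrightarrow> p = q + (if s < r then 1 else 0)"
proof -
  consider (below) "p < q" | (same) "p = q" | (raised) "p = q + 1" | (above) "q + 2 \<le> p"
    by linarith
  then show ?thesis
  proof cases
    case below
    then have "(p + 1) * t \<le> q * t" by (intro mult_le_mono1) simp
    with below assms show ?thesis by (simp add: flat_step_def)
  next
    case above
    then have "(q + 2) * t \<le> p * t" by (rule mult_le_mono1)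
    with above assms show ?thesis by (simp add: flat_step_def)
  qed (use assms in \<open>auto simp: flat_step_def\<close>)
qed

lemma flat_step_iff_div:
  assumes "t > 0"
  shows "flat_step t m n \<longleftrightarrow> n div t = m div t + (if n mod t < m mod t then 1 else 0)"
  using flat_step_mult_add_iff[of "m mod t" t "n mod t" "m div t" "n div t"] assms by simp

lemma ex1_flat_step_mod:
  assumes "a < t"
  shows "\<exists>!n. flat_step t m n \<and> n mod t = a"
proof -
  let ?q = "m div t + (if a < m mod t then 1 else 0)"
  have "flat_step t m n \<and> n mod t = a \<longleftrightarrow> n div t = ?q \<and> n mod t = a" for n
    using assms by (auto simp: flat_step_iff_div)
  moreover have "n div t = q \<and> n mod t = a \<longleftrightarrow> n = q * t + a" for n q
    using assms by auto
  ultimately show ?thesis by auto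
qed

lemma residue_vector_Nil [simp]: "residue_vector t [] = []"
  by (simp add: residue_vector_def)

lemma residue_vector_Cons [simp]: "residue_vector t (n # l) = n mod t # residue_vector t l"
  by (simp add: residue_vector_def)

lemma residue_vector_rev: "residue_vector t (rev l) = rev (residue_vector t l)"
  by (simp add: residue_vector_def rev_map)

lemma length_residue_vector [simp]: "length (residue_vector t l) = length l"
  by (simp add: residue_vector_def)

lemma ex1_flat_chain_residue_vector:
  assumes "\<And>a. a \<in> set w \<Longrightarrow> a < t"
  shows "\<exists>!u. successively (flat_step t) (m # u) \<and> residue_vector t u = w"
  using assms
proof (induction w arbitrary: m)
  case Nil
  then show ?case by (auto simp: residue_vector_def)
next
  case (Cons a w)
  obtain n where n: "flat_step t m n" "n mod t = a"
    and n_unique: "\<And>k. flat_step t m k \<Longrightarrow> k mod t = a \<Longrightarrow> k = n"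
    using ex1_flat_step_mod[of a t m] Cons.prems by (metis list.set_intros(1))
  obtain u where u: "successively (flat_step t) (n # u)" "residue_vector t u = w"
    and u_unique: "\<And>v. successively (flat_step t) (n # v) \<Longrightarrow> residue_vector t v = w \<Longrightarrow> v = u"
    using Cons.IH[of n] Cons.prems by (metis list.set_intros(2))
  show ?case
  proof (rule ex1I[of _ "n # u"])
    show "successively (flat_step t) (m # n # u) \<and> residue_vector t (n # u) = a # w"
      using n u by simp
  next
    fix v assume v: "successively (flat_step t) (m # v) \<and> residue_vector t v = a # w"
    then obtain k v' where "v = k # v'" by (cases v) auto
    with v show "v = n # u"
      using n_unique[of k] u_unique[of v'] by simp
  qed
qed

lemma sum_list_flat_chain:
  assumes "t > 0" "successively (flat_step t) (m # u)"
  shows "sum_list (m # u) = sum_list (residue_vector t (m # u)) +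
    t * (comaj (residue_vector t (m # u)) + m div t * length (m # u))"
  using assms(2)
proof (induction u arbitrary: m)
  case Nil
  then show ?case by simp
next
  case (Cons n u)
  have "n div t = m div t + (if n mod t < m mod t then 1 else 0)"
    using Cons.prems assms(1) by (simp add: flat_step_iff_div)
  moreover have "sum_list (n # u) = sum_list (residue_vector t (n # u)) +
      t * (comaj (residue_vector t (n # u)) + n div t * length (n # u))"
    using Cons.prems by (intro Cons.IH) simp
  moreover have "m = m mod t + t * (m div t)"
    by simp
  ultimately show ?case
    by (simp add: algebra_simps)
qed

lemma partition_flat_iff_flat_chain:
  "sorted_wrt (\<ge>) l \<and> flat_partition t l \<longleftrightarrow> successively (flat_step t) (0 # rev l)"
proof -
  have decreasing: "sorted_wrt (\<ge>) l \<longleftrightarrow> successively (\<ge>) l"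
    by (rule successively_conv_sorted_wrt[symmetric]) (auto simp: transp_def)
  have "successively (flat_step t) (0 # rev l) \<longleftrightarrow>
      (l \<noteq> [] \<longrightarrow> last l < t) \<and> successively (\<lambda>x y. y \<le> x \<and> x < y + t) l"
    by (auto simp: successively_Cons hd_rev flat_step_def)
  then show ?thesis
    unfolding decreasing flat_partition_def successively_conv_nth
    by (auto simp: less_diff_conv2 add.commute)
qed

lemma RF_partitions_iff_flat_chain:
  "l \<in> RF_partitions t \<rho> \<longleftrightarrow>
    successively (flat_step t) (0 # rev l) \<and> 0 \<notin># \<rho> \<and> mset (residue_vector t l) = \<rho>"
proof -
  have "(\<forall>x\<in>set l. 0 < x) \<and> regular_partition t l \<longleftrightarrow> 0 \<notin># mset (residue_vector t l)"
    by (force simp: regular_partition_def residue_vector_def dvd_eq_mod_eq_0 intro: gr0I)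
  then show ?thesis
    unfolding partition_flat_iff_flat_chain[symmetric] RF_partitions_def is_partition_def by auto
qed

lemma bij_betw_residue_word:
  assumes "\<And>r. r \<in># \<rho> \<Longrightarrow> 0 < r \<and> r < t"
  shows "bij_betw (\<lambda>l. rev (residue_vector t l)) (RF_partitions t \<rho>) (permutations_of_multiset \<rho>)"
proof -
  have RF_iff: "l \<in> RF_partitions t \<rho> \<longleftrightarrow> successively (flat_step t) (0 # rev l) \<and>
      rev (residue_vector t l) \<in> permutations_of_multiset \<rho>" for l
    using assms by (auto simp: RF_partitions_iff_flat_chain permutations_of_multiset_def)
  have "\<exists>!l. l \<in> RF_partitions t \<rho> \<and> rev (residue_vector t l) = w"
    if "w \<in> permutations_of_multiset \<rho>" for w
  proof -
    have "a < t" if "a \<in> set w" for a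
      using that assms permutations_of_multisetD[OF \<open>w \<in> _\<close>] by (metis set_mset_mset)
    then have "\<exists>!u. successively (flat_step t) (0 # u) \<and> residue_vector t u = w"
      by (rule ex1_flat_chain_residue_vector)
    then have "\<exists>!l. successively (flat_step t) (0 # rev l) \<and> rev (residue_vector t l) = w"
      by (metis residue_vector_rev rev_rev_ident)
    with that show ?thesis
      unfolding RF_iff by (metis (no_types, lifting))
  qed
  moreover have "rev (residue_vector t l) \<in> permutations_of_multiset \<rho>"
    if "l \<in> RF_partitions t \<rho>" for l
    using that by (simp add: RF_iff)
  ultimately show ?thesis
    unfolding bij_betw_def inj_on_def by blast
qed

lemma sum_list_RF_partition:
  assumes "t > 0" "l \<in> RF_partitions t \<rho>"
  shows "sum_list l = sum_mset \<rho> + t * comaj (rev (residue_vector t l))"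
proof -
  let ?w = "rev (residue_vector t l)"
  have "sum_list l = sum_list ?w + t * comaj (0 # ?w)"
    using assms sum_list_flat_chain[of t 0 "rev l"]
    by (simp add: RF_partitions_iff_flat_chain residue_vector_rev)
  moreover have "sum_list ?w = sum_mset \<rho>"
    using assms(2) by (auto simp: RF_partitions_def sum_mset_sum_list)
  ultimately show ?thesis
    by (simp add: comaj_Cons_le)
qed

section \<open>Generating functions\<close>

lemma partition_gf_finite:
  assumes "finite A"
  shows "partition_gf A = (\<Sum>l\<in>A. fps_X ^ sum_list l)"
proof (rule fps_ext)
  fix n
  have "fps_nth (partition_gf A) n = (\<Sum>l\<in>A. if sum_list l = n then 1 else 0)"
    using assms by (simp add: partition_gf_def sum.If_cases Int_def)
  also have "\<dots> = fps_nth (\<Sum>l\<in>A. fps_X ^ sum_list l) n"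
    by (auto simp: fps_sum_nth intro: sum.cong)
  finally show "fps_nth (partition_gf A) n = fps_nth (\<Sum>l\<in>A. fps_X ^ sum_list l) n" .
qed

lemma P_RF_eq_sum_comaj:
  assumes "t > 0" "\<And>r. r \<in># \<rho> \<Longrightarrow> 0 < r \<and> r < t"
  shows "P_RF t \<rho> =
    fps_X ^ sum_mset \<rho> * (\<Sum>w\<in>permutations_of_multiset \<rho>. (fps_X ^ t) ^ comaj w)"
proof -
  have bij: "bij_betw (\<lambda>l. rev (residue_vector t l))
      (RF_partitions t \<rho>) (permutations_of_multiset \<rho>)"
    using assms(2) by (rule bij_betw_residue_word)
  have "finite (RF_partitions t \<rho>)"
    using bij_betw_finite[OF bij] by simp
  then have "P_RF t \<rho> = (\<Sum>l\<in>RF_partitions t \<rho>. fps_X ^ sum_list l)"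
    by (simp add: P_RF_def partition_gf_finite)
  also have "\<dots> = (\<Sum>l\<in>RF_partitions t \<rho>.
      fps_X ^ sum_mset \<rho> * (fps_X ^ t) ^ comaj (rev (residue_vector t l)))"
    using assms(1)
    by (intro sum.cong refl) (simp add: sum_list_RF_partition power_add power_mult)
  also have "\<dots> = (\<Sum>w\<in>permutations_of_multiset \<rho>. fps_X ^ sum_mset \<rho> * (fps_X ^ t) ^ comaj w)"
    by (rule sum.reindex_bij_betw[OF bij])
  finally show ?thesis
    by (simp add: sum_distrib_left)
qed

lemma set_mset_residue_multiset: "set_mset (residue_multiset t i) \<subseteq> {1..t-1}"
  unfolding residue_multiset_def by (auto simp: set_mset_sum split: if_splits)

lemma sum_mset_residue_multiset: "sum_mset (residue_multiset t i) = (\<Sum>r=1..t-1. r * i r)"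
  unfolding residue_multiset_def
  by (subst sum_comp_morphism[of sum_mset, symmetric]) (auto simp: comp_def mult.commute)

theorem theorem11:
  fixes t :: nat and i :: "nat \<Rightarrow> nat"
  assumes "t \<ge> 2"
  shows "P_RF t (residue_multiset t i) =
    fps_X ^ (\<Sum>r=1..t-1. r * i r) * qmultinomial {1..t-1} i (fps_X ^ t)"
proof -
  let ?\<rho> = "residue_multiset t i"
  have "0 < r \<and> r < t" if "r \<in># ?\<rho>" for r
    using that set_mset_residue_multiset[of t i] assms by force
  then have "P_RF t ?\<rho> =
      fps_X ^ sum_mset ?\<rho> * (\<Sum>w\<in>permutations_of_multiset ?\<rho>. (fps_X ^ t) ^ comaj w)"
    using assms by (intro P_RF_eq_sum_comaj) auto
  also have "(\<Sum>w\<in>permutations_of_multiset ?\<rho>. (fps_X ^ t) ^ comaj w) =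
      qmultinomial {1..t-1} i (fps_X ^ t)"
    unfolding residue_multiset_def using assms
    by (intro qmultinomial_eq_sum_comaj[symmetric]) simp_all
  finally show ?thesis
    by (simp only: sum_mset_residue_multiset)
qed

end
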